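(* Let $n\geq 1$ be an integer and let $x_1,\dots,x_n$ be pairwise distinct non-negative real numbers. For each $i\in\{1,\dots,n\}$ put $$a_i:=\frac{\prod_{1\le j\le n,\ j\neq i}x_j}{\prod_{1\le j\le n,\ j\neq i}(x_j-x_i)}.$$ Then $$\prod_{i=1}^n(1+x_i)^{a_i}\leq \exp\left(\frac{1}{n}\prod_{i=1}^n x_i\right).$$ Moreover, equality holds if and only if one of the numbers $x_1,\dots,x_n$ equals zero.
   Context: Empty products are equal to $1$ (so for $n=1$ one has $a_1=1$ and the inequality reads $1+x_1\le e^{x_1}$). The exponents $a_i$ are real numbers, and $(1+x_i)^{a_i}$ denotes the real power of the positive real number $1+x_i$. *)

theory Defs
  imports Complex_Main
begin

definition expo :: "nat \<Rightarrow> (nat \<Rightarrow> real) \<Rightarrow> nat \<Rightarrow> real" where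
  "expo n x i = (\<Prod>j\<in>{1..n} - {i}. x j) / (\<Prod>j\<in>{1..n} - {i}. (x j - x i))"

end

(* With f s = (\<Sum>i. a_i * ln (1 + s * x_i)), the partial fraction identity
     (\<Sum>i. a_i * x_i / (1 + s * x_i)) = s^(n-1) * (\<Prod>i. x_i) / (\<Prod>i. 1 + s * x_i)
   shows that f' s < s^(n-1) * (\<Prod>i. x_i) for s > 0 when all x_i are positive. Integrating
   over [0,1] bounds f 1, the logarithm of the left-hand side, by (\<Prod>i. x_i) / n.
   If some x_k = 0, then all a_i with i \<noteq> k vanish and both sides are 1. *)
theory Submission
  imports Defs "HOL-Computational_Algebra.Polynomial"
begin

text \<open>Lagrange interpolation of a monomial: as polynomials in \<open>s\<close>, both sides
  have degree at most \<open>card I - 1\<close>, and they agree at the \<open>card I\<close>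
  distinct points \<open>- inverse (x k)\<close>.\<close>

lemma lagrange_partial_fractions:
  fixes x :: "'i \<Rightarrow> 'a::field"
  assumes I: "finite I" "I \<noteq> {}" and inj: "inj_on x I" and nz: "\<And>i. i \<in> I \<Longrightarrow> x i \<noteq> 0"
  shows "(\<Sum>i\<in>I. (\<Prod>j\<in>I - {i}. x j) / (\<Prod>j\<in>I - {i}. x j - x i) * x i * (\<Prod>j\<in>I - {i}. 1 + s * x j))
    = s ^ (card I - 1) * (\<Prod>i\<in>I. x i)"
proof -
  define w where "w i = (\<Prod>j\<in>I - {i}. x j) / (\<Prod>j\<in>I - {i}. x j - x i)" for i
  define p where "p = (\<Sum>i\<in>I. smult (w i * x i) (\<Prod>j\<in>I - {i}. [:1, x j:]))"
  define q where "q = monom (\<Prod>i\<in>I. x i) (card I - 1)"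
  define A where "A = (\<lambda>k. - inverse (x k)) ` I"
  have "inj_on (\<lambda>k. - inverse (x k)) I"
    using inj by (auto simp: inj_on_def)
  then have cardA: "card A = card I"
    by (simp add: A_def card_image)
  have cardI: "card I > 0"
    using I by (simp add: card_gt_0_iff)
  have "degree (\<Prod>j\<in>I - {i}. [:1, x j:]) \<le> card I - 1" if "i \<in> I" for i
  proof -
    have "degree (\<Prod>j\<in>I - {i}. [:1, x j:]) \<le> (\<Sum>j\<in>I - {i}. degree [:1, x j:])"
      using I degree_prod_sum_le[of "I - {i}" "\<lambda>j. [:1, x j:]"] by (simp add: o_def)
    also have "\<dots> \<le> (\<Sum>j\<in>I - {i}. 1)"
      by (rule sum_mono) simp
    finally show ?thesis
      using I that by simp
  qed
  then have "degree p \<le> card I - 1"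
    unfolding p_def by (intro degree_sum_le I) (meson degree_smult_le order_trans)
  then have degp: "degree p < card A"
    using cardA cardI by linarith
  have "degree q \<le> card I - 1"
    unfolding q_def by (rule degree_monom_le)
  then have degq: "degree q < card A"
    using cardA cardI by linarith
  have "poly p t = poly q t" if "t \<in> A" for t
  proof -
    obtain k where k: "k \<in> I" "t = - inverse (x k)"
      using \<open>t \<in> A\<close> by (auto simp: A_def)
    \<comment> \<open>At \<open>t = - 1 / x k\<close> the factor with \<open>j = k\<close> is zero,
      so only the \<open>k\<close>-th summand of \<open>p\<close> survives.\<close>
    have vanish: "(\<Prod>j\<in>I - {i}. 1 + t * x j) = 0" if "i \<in> I - {k}" for i
      using I k nz that by (intro prod_zero) (auto intro!: bexI[of _ k])
    have D: "(\<Prod>j\<in>I - {k}. x j - x k) \<noteq> 0"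
      using I inj k by (auto simp: inj_on_def)
    \<comment> \<open>Since \<open>t * x k = - 1\<close>, the constant 1 can be replaced by
      \<open>- t * x k\<close>. This produces the differences that cancel the denominator of
      \<open>w k\<close>.\<close>
    have "(\<Prod>j\<in>I - {k}. 1 + t * x j) = (\<Prod>j\<in>I - {k}. t * (x j - x k))"
      using k nz by (intro prod.cong) (auto simp: field_simps)
    also have "\<dots> = t ^ (card I - 1) * (\<Prod>j\<in>I - {k}. x j - x k)"
      unfolding prod.distrib prod_constant using I k by simp
    finally have main: "(\<Prod>j\<in>I - {k}. 1 + t * x j) = t ^ (card I - 1) * (\<Prod>j\<in>I - {k}. x j - x k)" .
    have "poly p t = (\<Sum>i\<in>I. w i * x i * (\<Prod>j\<in>I - {i}. 1 + t * x j))"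
      by (simp add: p_def poly_sum poly_prod)
    also have "\<dots> = w k * x k * (\<Prod>j\<in>I - {k}. 1 + t * x j)"
      unfolding sum.remove[OF I(1) k(1)] using vanish by simp
    also have "\<dots> = t ^ (card I - 1) * (x k * (\<Prod>j\<in>I - {k}. x j))"
      unfolding main w_def using D by simp
    also have "\<dots> = poly q t"
      using I k by (simp add: q_def poly_monom prod.remove[of I k] mult.commute)
    finally show ?thesis .
  qed
  then have "p = q"
    using degp degq by (rule poly_eqI_degree)
  then have "poly p s = poly q s"
    by simp
  then show ?thesis
    by (simp add: p_def q_def w_def poly_sum poly_prod poly_monom mult.commute)
qed

text \<open>The logarithmic form of the bound for positive entries. Integration is replaced by
  monotonicity of \<open>F\<close>: \<open>F 0 = 0\<close>, and \<open>F 1\<close> is the gap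
  between the two sides.\<close>

lemma sum_expo_ln_less:
  assumes n: "n \<ge> 1" and inj: "inj_on x {1..n}" and pos: "\<And>i. i \<in> {1..n} \<Longrightarrow> x i > 0"
  shows "(\<Sum>i=1..n. expo n x i * ln (1 + x i)) < (\<Prod>i=1..n. x i) / n"
proof -
  define P where "P = (\<Prod>i=1..n. x i)"
  define F where "F s = s ^ n / n * P - (\<Sum>i=1..n. expo n x i * ln (1 + s * x i))" for s :: real
  define F' where "F' s = s ^ (n - 1) * P - (\<Sum>i=1..n. expo n x i * x i / (1 + s * x i))" for s :: real
  have fac: "1 + s * x i > 0" if "s \<ge> 0" "i \<in> {1..n}" for s i
    using pos[OF that(2)] that(1) by (simp add: add_pos_nonneg)
  have deriv: "(F has_real_derivative F' s) (at s)" if "s \<ge> 0" for s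
    unfolding F_def F'_def using n
    by (auto intro!: derivative_eq_intros sum.cong simp: fac[OF that] field_simps)
  \<comment> \<open>The point \<open>s = 0\<close> must be left out, because \<open>F' 0 = 0\<close>
    by the partial fraction identity.\<close>
  have "F' s > 0" if "s > 0" for s
  proof -
    define Q where "Q = (\<Prod>i=1..n. 1 + s * x i)"
    have "Q > 1"
      unfolding Q_def using n pos that by (intro less_1_prod) auto
    have Q: "Q = (1 + s * x i) * (\<Prod>j\<in>{1..n} - {i}. 1 + s * x j)" if "i \<in> {1..n}" for i
      unfolding Q_def using that by (intro prod.remove) auto
    \<comment> \<open>Multiplying by \<open>Q\<close> clears the denominators and gives the
      polynomial form of the identity.\<close>
    have "Q * (\<Sum>i=1..n. expo n x i * x i / (1 + s * x i))
        = (\<Sum>i=1..n. expo n x i * x i * (\<Prod>j\<in>{1..n} - {i}. 1 + s * x j))"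
      unfolding sum_distrib_left
    proof (rule sum.cong)
      fix i assume i: "i \<in> {1..n}"
      show "Q * (expo n x i * x i / (1 + s * x i))
          = expo n x i * x i * (\<Prod>j\<in>{1..n} - {i}. 1 + s * x j)"
        unfolding Q[OF i] using fac[OF _ i, of s] \<open>s > 0\<close> by simp
    qed simp
    also have "\<dots> = s ^ (n - 1) * P"
      using lagrange_partial_fractions[of "{1..n}" x s] n inj pos
      by (force simp: expo_def P_def)
    finally have "(\<Sum>i=1..n. expo n x i * x i / (1 + s * x i)) = s ^ (n - 1) * P / Q"
      using \<open>Q > 1\<close> by (simp add: field_simps)
    also have "\<dots> < s ^ (n - 1) * P"
    proof -
      have "s ^ (n - 1) * P > 0"
        unfolding P_def using pos that by (intro mult_pos_pos prod_pos) auto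
      then show ?thesis
        using \<open>Q > 1\<close> mult_strict_left_mono[of 1 Q "s ^ (n - 1) * P"]
        by (simp add: divide_less_eq)
    qed
    finally show ?thesis
      by (simp add: F'_def)
  qed
  \<comment> \<open>A positive derivative on the open interval suffices, given continuity on the
    closed one; the latter uses \<open>deriv\<close> at 0 as well.\<close>
  then have "F 0 < F 1"
    by (intro DERIV_pos_imp_increasing_open[of 0 1 F] continuous_at_imp_continuous_on)
      (auto intro: deriv DERIV_isCont[OF deriv] less_imp_le)
  then show ?thesis
    using n by (simp add: F_def P_def power_0_left)
qed

text \<open>Nonnegativity keeps each base \<open>1 + x i\<close> away from 0, where
  \<open>powr\<close> takes the default value 0 instead of an exponential.\<close>

lemma prod_powr_expo_eq_exp:
  assumes "\<And>i. i \<in> {1..n} \<Longrightarrow> x i \<ge> 0"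
  shows "(\<Prod>i=1..n. (1 + x i) powr expo n x i) = exp (\<Sum>i=1..n. expo n x i * ln (1 + x i))"
  unfolding exp_sum[OF finite_atLeastAtMost]
  by (rule prod.cong) (use assms in \<open>force simp: powr_def\<close>)+

lemma expo_eq_0:
  assumes "k \<in> {1..n}" "k \<noteq> i" "x k = 0"
  shows "expo n x i = 0"
proof -
  have "(\<Prod>j\<in>{1..n} - {i}. x j) = 0"
    using assms by (intro prod_zero) auto
  then show ?thesis
    by (simp add: expo_def)
qed

theorem mainTheorem1:
  fixes n :: nat and x :: "nat \<Rightarrow> real"
  assumes "n \<ge> 1"
    and "inj_on x {1..n}"
    and "\<And>i. i \<in> {1..n} \<Longrightarrow> x i \<ge> 0"
  shows "(\<Prod>i=1..n. (1 + x i) powr expo n x i) \<le> exp ((1 / real n) * (\<Prod>i=1..n. x i))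
    \<and> ((\<Prod>i=1..n. (1 + x i) powr expo n x i) = exp ((1 / real n) * (\<Prod>i=1..n. x i))
        \<longleftrightarrow> (\<exists>i\<in>{1..n}. x i = 0))"
proof (cases "\<exists>i\<in>{1..n}. x i = 0")
  case True
  then obtain k where k: "k \<in> {1..n}" "x k = 0"
    by blast
  \<comment> \<open>For \<open>i = k\<close> the base is 1, whatever the exponent; for the other
    indices the exponent is 0 and the base is positive.\<close>
  have "(1 + x i) powr expo n x i = 1" if "i \<in> {1..n}" for i
    using expo_eq_0[of k n i x] k assms(3)[OF that] by (cases "i = k") auto
  then have "(\<Prod>i=1..n. (1 + x i) powr expo n x i) = 1"
    by simp
  moreover have "(\<Prod>i=1..n. x i) = 0"
    using k by (intro prod_zero) auto
  ultimately show ?thesis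
    using True by (simp only: mult_zero_right exp_zero) simp
next
  case False
  then have "\<And>i. i \<in> {1..n} \<Longrightarrow> x i > 0"
    using assms(3) by (metis order_le_less)
  then have "(\<Sum>i=1..n. expo n x i * ln (1 + x i)) < (\<Prod>i=1..n. x i) / n"
    using assms(1,2) by (intro sum_expo_ln_less)
  then have "(\<Prod>i=1..n. (1 + x i) powr expo n x i) < exp ((1 / real n) * (\<Prod>i=1..n. x i))"
    using prod_powr_expo_eq_exp[OF assms(3)] by simp
  \<comment> \<open>The strict inequality gives the bound and rules out equality, so both sides of
    the equivalence are false.\<close>
  then show ?thesis
    using False by linarith
qed

end
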